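(* Let $\mu,a_1,a_2,p_1,p_2>0$, $T=p_1+p_2$, and let $$m=\Big[2\frac{a_2}{a_1}-e^{-\mu}\Big](2-e^{-\mu})\,e^{-\mu(T-2)},$$ $$b=\frac{2a_2-a_1e^{-\mu}}{\mu}(2-e^{-\mu})\,e^{-\mu(T-2)}+\frac{a_1-a_2}{\mu}e^{-\mu p_2}-\frac{a_2}{\mu}.$$ Assume $|m|<1$ and $b>0$, and put $h_*=b/(1-m)>0$. Assume further that $t_1:=\frac1\mu\ln\frac{\mu h_*+a_1}{a_1}$ and $t_2:=t_1+1+\frac1\mu\ln(2-e^{-\mu})$ satisfy $0<t_1<t_1+1<t_2<p_1<t_2+1<T$. Then the delay differential equation $$\dot x(t)=-\mu x(t)+a(t)f(x(t-1))$$ has a stable slowly oscillating periodic solution $x:\mathbb R\to\mathbb R$ of period $T$. Its initial state $x_0=x|_{[-1,0]}$ is obtained by starting with the constant initial function $\psi\equiv h_*$ on $[-1,0]$ and applying the period map, i.e. $x_0(s)=y(T+s)$ for $s\in[-1,0]$, where $y$ is the solution with $y|_{[-1,0]}\equiv h_*$. The function $-x$ is then also a periodic solution.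
   Context: Here $f(x)=-\operatorname{sign}(x)$, that is, $f(x)=-1$ for $x>0$, $f(0)=0$, $f(x)=+1$ for $x<0$; and $a:\mathbb R\to\mathbb R$ is the $T$-periodic function with $a(t)=a_1$ for $0\le t<p_1$ and $a(t)=a_2$ for $p_1\le t<T$. A solution is a continuous function satisfying the equation at all times $t$ at which $a$ is continuous and $x(t-1)\neq0$ (equivalently, it satisfies the variation-of-constants formula). A solution is slowly oscillating if the distance between consecutive zeros is larger than the delay $1$. Stability is meant in the usual (Lyapunov) sense with respect to perturbations of the initial state in $C^0([-1,0],\mathbb R)$ with the supremum norm. *)

theory Defs
  imports "HOL-Analysis.Analysis"
begin

definition feedback :: "real \<Rightarrow> real" where
  "feedback x = - sgn x"

definition dde_solution :: "real \<Rightarrow> (real \<Rightarrow> real) \<Rightarrow> (real \<Rightarrow> real) \<Rightarrow> bool" where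
  "dde_solution \<mu> a x \<longleftrightarrow>
     continuous_on UNIV x \<and>
     (\<forall>t. isCont a t \<and> x (t - 1) \<noteq> 0 \<longrightarrow>
        (x has_real_derivative (- \<mu> * x t + a t * feedback (x (t - 1)))) (at t))"

(* Solutions of the initial value problem at time 0: only the values on [-1, \<infinity>) matter,
   and the equation is not required at t = 0, where the initial state ends. *)

definition dde_forward_solution ::
    "real \<Rightarrow> (real \<Rightarrow> real) \<Rightarrow> (real \<Rightarrow> real) \<Rightarrow> (real \<Rightarrow> real) \<Rightarrow> bool" where
  "dde_forward_solution \<mu> a \<phi> z \<longleftrightarrow>
     continuous_on {-1..} z \<and>
     (\<forall>s\<in>{-1..0}. z s = \<phi> s) \<and>
     (\<forall>t>0. isCont a t \<and> z (t - 1) \<noteq> 0 \<longrightarrow>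
        (z has_real_derivative (- \<mu> * z t + a t * feedback (z (t - 1)))) (at t))"

(* The second clause compares any two distinct zeros, not just consecutive ones: this is the
   same when the zeros are isolated, and it excludes functions such as the zero function,
   which have no consecutive zeros at all.  The first clause is the word "oscillating". *)

definition slowly_oscillating :: "(real \<Rightarrow> real) \<Rightarrow> bool" where
  "slowly_oscillating x \<longleftrightarrow>
     (\<forall>t. (\<exists>s>t. x s = 0) \<and> (\<exists>s<t. x s = 0)) \<and>
     (\<forall>s t. s < t \<and> x s = 0 \<and> x t = 0 \<longrightarrow> t - s > 1)"

definition state :: "(real \<Rightarrow> real) \<Rightarrow> real \<Rightarrow> real \<Rightarrow> real" where
  "state x t = (\<lambda>s. x (t + s))"

definition state_dist :: "(real \<Rightarrow> real) \<Rightarrow> (real \<Rightarrow> real) \<Rightarrow> real" where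
  "state_dist \<phi> \<psi> = (SUP s\<in>{-1..0}. \<bar>\<phi> s - \<psi> s\<bar>)"

(* Existence of the perturbed solution is part of the definition, so that the estimate
   cannot hold vacuously. *)

definition lyapunov_stable :: "real \<Rightarrow> (real \<Rightarrow> real) \<Rightarrow> (real \<Rightarrow> real) \<Rightarrow> bool" where
  "lyapunov_stable \<mu> a x \<longleftrightarrow>
     (\<forall>\<epsilon>>0. \<exists>\<delta>>0. \<forall>\<phi>.
        continuous_on {-1..0} \<phi> \<and> state_dist \<phi> (state x 0) < \<delta> \<longrightarrow>
          (\<exists>z. dde_forward_solution \<mu> a \<phi> z) \<and>
          (\<forall>z. dde_forward_solution \<mu> a \<phi> z \<longrightarrow>
             (\<forall>t\<ge>0. state_dist (state z t) (state x t) < \<epsilon>)))"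

end

theory Submission
  imports Defs
begin

text \<open>
  The delayed term only sees the sign of the past. A positive initial function therefore influences
  the future only through its value \<open>u\<close> at time 0, and for \<open>u\<close> near \<open>h\<close> the solution over one period
  consists of four exponential arcs, ends with a positive stretch of length greater than 1, and takes
  the value \<open>m * u + b\<close> at time \<open>T\<close>. The fixed point of this affine map gives the periodic
  solution. As \<open>\<bar>m\<bar> < 1\<close>, the values at the times \<open>k * T\<close> of a perturbed solution stay as close to \<open>h\<close>
  as they were initially, and uniform continuity of the arcs in \<open>u\<close> yields stability.
\<close>

section \<open>Solutions of the delay equation\<close>

text \<open>L'Hopital's rule applied to the difference quotient; continuity of \<open>f\<close> at
  \<open>t\<close> makes its numerator tend to 0.\<close>

lemma has_real_derivative_of_limit:
  fixes f g :: "real \<Rightarrow> real"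
  assumes "isCont f t" and "\<forall>\<^sub>F s in at t. (f has_real_derivative g s) (at s)"
    and "(g \<longlongrightarrow> L) (at t)"
  shows "(f has_real_derivative L) (at t)"
  unfolding has_field_derivative_iff
proof (rule lhopital[where f' = g and g' = "\<lambda>_. 1"])
  show "((\<lambda>s. f s - f t) \<longlongrightarrow> 0) (at t)"
    using assms(1) by (simp add: isCont_def LIM_zero)
  show "((\<lambda>s. s - t) \<longlongrightarrow> 0) (at t)"
    by (intro LIM_zero tendsto_ident_at)
  show "\<forall>\<^sub>F s in at t. s - t \<noteq> 0"
    by (simp add: eventually_at_filter)
  show "\<forall>\<^sub>F s in at t. ((\<lambda>s. f s - f t) has_real_derivative g s) (at s)"
    using assms(2) by eventually_elim (auto intro!: derivative_eq_intros)
  show "\<forall>\<^sub>F s in at t. ((\<lambda>s. s - t) has_real_derivative 1) (at s)"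
    by (intro always_eventually allI) (auto intro!: derivative_eq_intros)
qed (use assms(3) in auto)

text \<open>
  At a point of \<open>E\<close> the equation may still be required (every switching time of \<open>a\<close> is such a point
  when \<open>a\<^sub>1 = a\<^sub>2\<close>); there it is recovered from the limit of the derivative.
\<close>
lemma dde_forward_solutionI:
  assumes cont: "continuous_on {-1..} z"
    and init: "\<And>s. s \<in> {-1..0} \<Longrightarrow> z s = \<phi> s"
    and fin: "\<And>c. finite (E \<inter> {0..c})"
    and deriv: "\<And>t. t > 0 \<Longrightarrow> t \<notin> E \<Longrightarrow>
      (z has_real_derivative (- \<mu> * z t + a t * feedback (z (t - 1)))) (at t)"
  shows "dde_forward_solution \<mu> a \<phi> z"
  unfolding dde_forward_solution_def
proof (intro conjI allI impI ballI; (elim conjE)?)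
  fix t :: real
  assume t: "t > 0" and a: "isCont a t" and z: "z (t - 1) \<noteq> 0"
  have isCont: "isCont z s" if "s > -1" for s
    using cont that by (intro continuous_on_interior[where S = "{-1..}"]) auto
  \<comment> \<open>Only finitely many points of \<open>E\<close> lie in this window. Deleting all
    of them except \<open>t\<close> leaves an open neighbourhood of \<open>t\<close>, even when
    \<open>t\<close> itself is in \<open>E\<close>.\<close>
  have "open ({0<..<t + 1} - (E \<inter> {0..t + 1} - {t}))"
    using fin by (intro open_Diff finite_imp_closed) auto
  then have near: "\<forall>\<^sub>F s in at t. s \<in> {0<..<t + 1} - (E \<inter> {0..t + 1} - {t})"
    using t by (intro eventually_at_topological[THEN iffD2] exI[of _ "{0<..<t + 1} - (E \<inter> {0..t + 1} - {t})"]) auto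
  have "\<forall>\<^sub>F s in at t. s \<noteq> t"
    by (simp add: eventually_at_filter)
  with near have ev: "\<forall>\<^sub>F s in at t. (z has_real_derivative (- \<mu> * z s + a s * feedback (z (s - 1)))) (at s)"
    by eventually_elim (use deriv in auto)
  have "isCont (\<lambda>s. z (s - 1)) t"
    using t by (intro isCont_o2[where g = z, OF _ isCont]) auto
  moreover have "isCont z t"
    using t by (intro isCont) auto
  ultimately have "((\<lambda>s. - \<mu> * z s + a s * feedback (z (s - 1))) \<longlongrightarrow>
      - \<mu> * z t + a t * feedback (z (t - 1))) (at t)"
    using a z unfolding feedback_def isCont_def by (intro tendsto_intros)
  then show "(z has_real_derivative (- \<mu> * z t + a t * feedback (z (t - 1)))) (at t)"
    by (rule has_real_derivative_of_limit[OF \<open>isCont z t\<close> ev])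
qed (use cont init in auto)

text \<open>
  The delayed term depends on the past only through its sign, so as long as the signs agree the
  difference of two solutions is a multiple of \<open>exp (- \<mu> * t)\<close>; this propagates by steps of length 1.
\<close>
lemma dde_forward_solution_unique:
  assumes y: "dde_forward_solution \<mu> a \<phi> y" and z: "dde_forward_solution \<mu> a \<psi> z"
    and sgn: "\<And>s. s \<in> {-1..0} \<Longrightarrow> sgn (\<phi> s) = sgn (\<psi> s)" and "\<phi> 0 = \<psi> 0"
    and fin: "\<And>c. finite (E \<inter> {0..c})"
    and regular: "\<And>t. t > 0 \<Longrightarrow> t \<notin> E \<Longrightarrow> isCont a t \<and> y (t - 1) \<noteq> 0"
    and t: "t \<ge> 0"
  shows "z t = y t"
proof -
  have "\<forall>t\<in>{0..real n}. z t = y t" for n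
  proof (induction n)
    case 0
    then show ?case
      using y z \<open>\<phi> 0 = \<psi> 0\<close> by (simp add: dde_forward_solution_def)
  next
    case (Suc n)
    define d where "d t = (z t - y t) * exp (\<mu> * t)" for t
    \<comment> \<open>The derivative of \<open>d\<close> is computed off this finite set only.
      Continuity of \<open>d\<close> bridges the gaps, so \<open>d\<close> is still
      constant.\<close>
    let ?K = "(E \<inter> {0..real (Suc n)}) \<union> {0, real (Suc n)}"
    have "continuous_on {0..real (Suc n)} z" "continuous_on {0..real (Suc n)} y"
      using y z by (auto simp: dde_forward_solution_def intro: continuous_on_subset)
    then have cont: "continuous_on {0..real (Suc n)} d"
      unfolding d_def by (intro continuous_intros)
    have deriv: "(d has_derivative (\<lambda>_. 0)) (at t within {0..real (Suc n)})"
      if "t \<in> {0..real (Suc n)} - ?K" for t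
    proof -
      have t: "0 < t" "t < real (Suc n)" "t \<notin> E"
        using that by auto
      have same: "sgn (z (t - 1)) = sgn (y (t - 1))"
      proof (cases "t \<le> 1")
        case True
        then show ?thesis
          using y z t sgn[of "t - 1"] by (simp add: dde_forward_solution_def)
      next
        case False
        then show ?thesis
          using t Suc by auto
      qed
      with regular[OF t(1,3)] have "z (t - 1) \<noteq> 0"
        by (metis sgn_0 sgn_eq_0_iff)
      then have "(z has_real_derivative (- \<mu> * z t + a t * feedback (z (t - 1)))) (at t)"
        and "(y has_real_derivative (- \<mu> * y t + a t * feedback (y (t - 1)))) (at t)"
        using y z t regular[OF t(1,3)] by (auto simp: dde_forward_solution_def)
      then have "(d has_real_derivative 0) (at t)"
        unfolding d_def feedback_def same
        by (auto intro!: derivative_eq_intros simp: algebra_simps)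
      then show ?thesis
        by (auto simp: has_field_derivative_def lambda_zero intro: has_derivative_at_withinI)
    qed
    have d_0: "d 0 = 0"
      using y z \<open>\<phi> 0 = \<psi> 0\<close> by (simp add: d_def dde_forward_solution_def)
    have "finite ?K"
      using fin by simp
    then have "d t = 0" if "t \<in> {0..real (Suc n)}" for t
      by (rule has_derivative_zero_unique_strong_interval[OF _ cont d_0]) (fact deriv, fact that)
    then show ?case
      by (simp add: d_def)
  qed
  moreover obtain n where "t \<le> real n"
    using real_arch_simple by blast
  ultimately show ?thesis
    using t by auto
qed

section \<open>Distance of states, spacing of zeros, and symmetry\<close>

lemma state_dist_le:
  assumes "\<And>s. s \<in> {-1..0} \<Longrightarrow> \<bar>\<phi> s - \<psi> s\<bar> \<le> e"
  shows "state_dist \<phi> \<psi> \<le> e"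
  unfolding state_dist_def by (intro cSUP_least) (use assms in auto)

text \<open>Compactness of [-1,0] bounds the differences, without which the real supremum would say
  nothing about single values.\<close>

lemma le_state_dist:
  assumes "continuous_on {-1..0} \<phi>" "continuous_on {-1..0} \<psi>" "s \<in> {-1..0}"
  shows "\<bar>\<phi> s - \<psi> s\<bar> \<le> state_dist \<phi> \<psi>"
proof -
  have "compact ((\<lambda>s. \<bar>\<phi> s - \<psi> s\<bar>) ` {-1..0})"
    using assms by (intro compact_continuous_image continuous_intros) auto
  then show ?thesis
    unfolding state_dist_def
    by (intro cSUP_upper[OF assms(3)] bounded_imp_bdd_above compact_imp_bounded)
qed

text \<open>Translates of \<open>r\<close> give zeros arbitrarily far in both directions. For the
  spacing, whole periods are subtracted until the earlier zero lies in [0,T). The later one is then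
  either \<open>s\<close>, with the earlier one at \<open>r\<close>, or at least \<open>T\<close>,
  which exceeds both \<open>r + 1\<close> and \<open>s + 1\<close>.\<close>

lemma slowly_oscillatingI:
  assumes "T > 0" and periodic: "\<And>t. x (t + T) = x t"
    and zeros: "\<And>t. 0 \<le> t \<Longrightarrow> t < T \<Longrightarrow> x t = 0 \<longleftrightarrow> t = r \<or> t = s"
    and order: "0 \<le> r" "r + 1 < s" "s + 1 < T"
  shows "slowly_oscillating x"
proof -
  have nat_shift: "x (t + real n * T) = x t" for t n
  proof (induction n)
    case (Suc n)
    then show ?case
      using periodic[of "t + real n * T"] by (simp add: algebra_simps)
  qed simp
  have shift: "x (t + of_int k * T) = x t" for t k
  proof (cases "k \<ge> 0")
    case True
    then show ?thesis
      using nat_shift[of t "nat k"] by simp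
  next
    case False
    then show ?thesis
      using nat_shift[of "t + of_int k * T" "nat (- k)"] by simp
  qed
  have r: "x (r + of_int k * T) = 0" for k
    using zeros[of r] order shift by simp
  show ?thesis
    unfolding slowly_oscillating_def
  proof (intro conjI allI impI)
    fix t :: real
    \<comment> \<open>\<open>r + ?k * T\<close> is the last translate not after \<open>t\<close>. It
      may equal \<open>t\<close>, so the strictly earlier zero is taken one period further
      back.\<close>
    let ?k = "\<lfloor>(t - r) / T\<rfloor>"
    have "(t - r) / T < of_int (?k + 1)" "of_int (?k - 1) < (t - r) / T"
      by linarith+
    then have "t < r + of_int (?k + 1) * T" "r + of_int (?k - 1) * T < t"
      using \<open>T > 0\<close> by (simp_all add: field_simps)
    then show "\<exists>s>t. x s = 0" "\<exists>s<t. x s = 0"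
      using r by blast+
  next
    fix u v :: real
    assume uv: "u < v \<and> x u = 0 \<and> x v = 0"
    let ?k = "- \<lfloor>u / T\<rfloor>"
    define u' v' where "u' = u + of_int ?k * T" and "v' = v + of_int ?k * T"
    have u': "0 \<le> u'" "u' < T"
      using floor_divide_lower[OF \<open>T > 0\<close>, of u] floor_divide_upper[OF \<open>T > 0\<close>, of u]
      by (simp_all add: u'_def algebra_simps)
    have "x u' = 0" "x v' = 0" "u' < v'"
      using uv shift[of u ?k] shift[of v ?k] by (simp_all add: u'_def v'_def)
    then have "v' - u' > 1"
      using zeros[of u'] zeros[of v'] u' order by (cases "v' < T") auto
    then show "v - u > 1"
      by (simp add: u'_def v'_def)
  qed
qed

text \<open>The equation is invariant under negation because \<open>feedback\<close> is odd.\<close>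

lemma dde_solution_uminus:
  assumes "dde_solution \<mu> a x"
  shows "dde_solution \<mu> a (\<lambda>t. - x t)"
  unfolding dde_solution_def
proof (intro conjI allI impI)
  show "continuous_on UNIV (\<lambda>t. - x t)"
    using assms by (intro continuous_intros) (simp add: dde_solution_def)
  fix t assume "isCont a t \<and> - x (t - 1) \<noteq> 0"
  then have "(x has_real_derivative (- \<mu> * x t + a t * feedback (x (t - 1)))) (at t)"
    using assms by (simp add: dde_solution_def)
  from DERIV_minus[OF this]
  show "((\<lambda>t. - x t) has_real_derivative
      (- \<mu> * - x t + a t * feedback (- x (t - 1)))) (at t)"
    by (simp add: feedback_def sgn_minus algebra_simps)
qed

section \<open>One period\<close>

text \<open>The phases of \<open>a\<close> have lengths \<open>p\<close> and \<open>T - p\<close>.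
  The initial value is not fixed here, because perturbed solutions need the same analysis with
  varying values.\<close>

locale periodic_negative_feedback =
  fixes \<mu> a1 a2 p T :: real and a :: "real \<Rightarrow> real"
  assumes pos: "\<mu> > 0" "a1 > 0" "a2 > 0"
    and switch: "0 < p" "p < T"
    and periodic: "\<And>t. a (t + T) = a t"
    and first: "\<And>t. 0 \<le> t \<Longrightarrow> t < p \<Longrightarrow> a t = a1"
    and second: "\<And>t. p \<le> t \<Longrightarrow> t < T \<Longrightarrow> a t = a2"
begin

text \<open>The solution after time \<open>s\<close> of the linear equation with constant forcing
  \<open>k\<close>, started at \<open>v\<close>; its equilibrium is
  \<open>k / \<mu>\<close>.\<close>

definition flow :: "real \<Rightarrow> real \<Rightarrow> real \<Rightarrow> real" where
  "flow k v s = k / \<mu> + (v - k / \<mu>) * exp (- \<mu> * s)"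

text \<open>The time at which the arc with forcing \<open>- a1\<close> reaches 0 from
  \<open>h\<close>.\<close>

definition zero1 :: "real \<Rightarrow> real" where
  "zero1 h = ln ((\<mu> * h + a1) / a1) / \<mu>"

text \<open>One unit after the first zero the forcing changes to \<open>a1\<close>. The value is
  then \<open>a1 / \<mu> * (exp (- \<mu>) - 1)\<close>, and the logarithm is the time needed to
  climb back to 0.\<close>

definition zero2 :: "real \<Rightarrow> real" where
  "zero2 h = zero1 h + 1 + ln (2 - exp (- \<mu>)) / \<mu>"

text \<open>
  The four pieces of the solution over one period, with constant forcing \<open>- a1\<close>, \<open>a1\<close>, \<open>a2\<close>, \<open>- a2\<close>.
  Clamping the times spent in the pieces replaces a case distinction, so that joint continuity in
  the initial value and the time is immediate.
\<close>
definition orbit :: "real \<Rightarrow> real \<Rightarrow> real" where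
  "orbit h t =
     flow (- a2)
      (flow a2
        (flow a1
          (flow (- a1) h (min t (zero1 h + 1)))
          (max 0 (min t p - (zero1 h + 1))))
        (max 0 (min t (zero2 h + 1) - p)))
      (max 0 (t - (zero2 h + 1)))"

text \<open>The affine period map \<open>m * h + b\<close>; \<open>orbit_T\<close> shows that it is
  the value of the orbit at time \<open>T\<close>.\<close>

definition return :: "real \<Rightarrow> real" where
  "return h =
     (2 * (a2 / a1) - exp (- \<mu>)) * (2 - exp (- \<mu>)) * exp (- \<mu> * (T - 2)) * h
     + ((2 * a2 - a1 * exp (- \<mu>)) / \<mu> * (2 - exp (- \<mu>)) * exp (- \<mu> * (T - 2))
        + (a1 - a2) / \<mu> * exp (- \<mu> * (T - p)) - a2 / \<mu>)"

text \<open>The inequalities put the switching times into the order built into \<open>orbit\<close>.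
  Positivity of \<open>return h\<close> keeps the decreasing last arc positive, so the next period
  again starts from a positive state.\<close>

definition admissible :: "real \<Rightarrow> bool" where
  "admissible h \<longleftrightarrow> 0 < h \<and> zero2 h < p \<and> p < zero2 h + 1 \<and> zero2 h + 1 < T \<and> 0 < return h"

lemma flow_0 [simp]: "flow k v 0 = v"
  by (simp add: flow_def)

lemma has_real_derivative_flow:
  "((\<lambda>t. flow k v (t - c)) has_real_derivative (- \<mu> * flow k v (t - c) + k)) (at t)"
  unfolding flow_def using pos by (auto intro!: derivative_eq_intros simp: field_simps)

text \<open>The flow is a convex combination of \<open>v\<close> and the equilibrium.\<close>

lemma flow_pos:
  assumes "k > 0" "v > 0" "s \<ge> 0"
  shows "flow k v s > 0"
proof -
  have "exp (- \<mu> * s) \<le> 1"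
    using assms pos by simp
  then have "k / \<mu> * (1 - exp (- \<mu> * s)) \<ge> 0" "v * exp (- \<mu> * s) > 0"
    using assms pos by auto
  then show ?thesis
    by (simp add: flow_def algebra_simps)
qed

text \<open>The start \<open>v\<close> lies on or above the equilibrium, towards which the flow
  decays.\<close>

lemma flow_antimono:
  assumes "k \<le> 0" "v \<ge> 0" "s \<le> s'"
  shows "flow k v s' \<le> flow k v s"
proof -
  have "k / \<mu> \<le> 0"
    using assms pos by (simp add: divide_nonpos_pos)
  then have "v - k / \<mu> \<ge> 0"
    using assms by simp
  then show ?thesis
    using assms pos by (simp add: flow_def mult_left_mono)
qed

lemma one_less_decay: "1 < 2 - exp (- \<mu>)"
  using pos by simp

lemma zero1_plus_1_less_zero2: "zero1 h + 1 < zero2 h"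
  using pos divide_pos_pos[OF ln_gt_zero[OF one_less_decay]] by (simp add: zero2_def)

lemma exp_zero1:
  assumes "h > 0"
  shows "exp (\<mu> * zero1 h) = (\<mu> * h + a1) / a1"
  using assms pos by (simp add: zero1_def add_pos_pos)

lemma exp_zero2: "exp (\<mu> * zero2 h) = exp (\<mu> * zero1 h) * exp \<mu> * (2 - exp (- \<mu>))"
proof -
  have "\<mu> * zero2 h = \<mu> * zero1 h + \<mu> + ln (2 - exp (- \<mu>))"
    using pos by (simp add: zero2_def field_simps)
  moreover have "exp (ln (2 - exp (- \<mu>))) = 2 - exp (- \<mu>)"
    using one_less_decay by (intro exp_ln) linarith
  ultimately show ?thesis
    by (simp add: exp_add)
qed

lemma zero1_pos: "h > 0 \<Longrightarrow> zero1 h > 0"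
  using pos unfolding zero1_def by (intro divide_pos_pos ln_gt_zero) (auto simp: field_simps)

section \<open>The explicit orbit of one admissible value\<close>

context
  fixes h assumes adm: "admissible h"
begin

lemma h_pos: "h > 0"
  using adm by (simp add: admissible_def)

lemma order:
  "0 < zero1 h" "zero1 h + 1 < zero2 h" "zero2 h < p" "p < zero2 h + 1" "zero2 h + 1 < T"
  using adm zero1_pos zero1_plus_1_less_zero2 by (simp_all add: admissible_def)

lemma orbit_0: "orbit h 0 = h"
  using order by (simp add: orbit_def)

lemma orbit_flow1:
  assumes "t \<le> zero1 h + 1"
  shows "orbit h t = flow (- a1) h t"
  using order assms by (simp add: orbit_def)

lemma orbit_flow2:
  assumes "zero1 h + 1 \<le> t" "t \<le> p"
  shows "orbit h t = flow a1 (orbit h (zero1 h + 1)) (t - (zero1 h + 1))"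
  using order assms by (simp add: orbit_def)

lemma orbit_flow3:
  assumes "p \<le> t" "t \<le> zero2 h + 1"
  shows "orbit h t = flow a2 (orbit h p) (t - p)"
  using order assms by (simp add: orbit_def)

lemma orbit_flow4:
  assumes "zero2 h + 1 \<le> t"
  shows "orbit h t = flow (- a2) (orbit h (zero2 h + 1)) (t - (zero2 h + 1))"
  using order assms by (simp add: orbit_def)

text \<open>Expressing an arc through its zero, here and in \<open>orbit_eq2\<close>, makes its sign
  visible.\<close>

lemma orbit_eq1:
  assumes "t \<le> zero1 h + 1"
  shows "orbit h t = a1 / \<mu> * (exp (\<mu> * (zero1 h - t)) - 1)"
proof -
  have "exp (\<mu> * (zero1 h - t)) = (\<mu> * h + a1) / a1 * exp (- \<mu> * t)"
    using exp_zero1[OF h_pos] by (simp add: right_diff_distrib exp_diff exp_minus divide_inverse)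
  then show ?thesis
    using pos assms by (simp add: orbit_flow1 flow_def field_simps)
qed

lemma orbit_eq2:
  assumes "zero1 h + 1 \<le> t" "t \<le> p"
  shows "orbit h t = a1 / \<mu> * (1 - exp (\<mu> * (zero2 h - t)))"
proof -
  have v: "orbit h (zero1 h + 1) = a1 / \<mu> * (exp (- \<mu>) - 1)"
    by (simp add: orbit_eq1)
  have "exp (\<mu> * (zero2 h - t)) = (2 - exp (- \<mu>)) * exp (- \<mu> * (t - (zero1 h + 1)))"
    by (simp add: right_diff_distrib distrib_left exp_diff exp_add exp_zero2)
      (simp add: exp_minus field_simps)
  then show ?thesis
    unfolding orbit_flow2[OF assms] v flow_def by (simp add: right_diff_distrib left_diff_distrib mult.assoc)
qed

lemma orbit_p_pos: "orbit h p > 0"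
  using order pos by (simp add: orbit_eq2 mult_pos_neg)

text \<open>Every decay factor that depends on \<open>h\<close> reduces to the single quantity
  \<open>X\<close>, which is affine in \<open>h\<close>; hence so is the final value.\<close>

lemma orbit_T: "orbit h T = return h"
proof -
  \<comment> \<open>\<open>X\<close> is the decay factor over the last arc, from
    \<open>zero2 h + 1\<close> to \<open>T\<close>.\<close>
  define X where "X = exp (- \<mu> * (T - 2)) * (2 - exp (- \<mu>)) * ((\<mu> * h + a1) / a1)"
  have X: "exp (\<mu> * (zero2 h + 1 - T)) = X"
  proof -
    have "exp (\<mu> * (zero2 h + 1 - T)) = exp (\<mu> * zero2 h) * exp (\<mu> * (1 - T))"
      by (simp add: exp_add[symmetric] algebra_simps)
    moreover have "exp (- \<mu> * (T - 2)) = exp \<mu> * exp (\<mu> * (1 - T))"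
      by (simp add: exp_add[symmetric] algebra_simps)
    ultimately show ?thesis
      unfolding X_def exp_zero1[OF h_pos, symmetric] exp_zero2 by simp
  qed
  \<comment> \<open>\<open>P\<close> is the decay factor over the whole second phase, hence the
    product of those of the third and fourth arcs.\<close>
  define P where "P = exp (- \<mu> * (T - p))"
  have P1: "exp (\<mu> * (zero2 h - p)) * P = exp (- \<mu>) * X"
    unfolding P_def X[symmetric] exp_add[symmetric] by (simp add: algebra_simps)
  have P2: "exp (- \<mu> * (zero2 h + 1 - p)) * X = P"
    unfolding P_def X[symmetric] exp_add[symmetric] by (simp add: algebra_simps)
  have p: "orbit h p = a1 / \<mu> * (1 - exp (\<mu> * (zero2 h - p)))"
    using order by (intro orbit_eq2) auto
  have q: "orbit h (zero2 h + 1) = a2 / \<mu> + (orbit h p - a2 / \<mu>) * exp (- \<mu> * (zero2 h + 1 - p))"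
    using order by (subst orbit_flow3) (auto simp: flow_def)
  have "orbit h T = - a2 / \<mu> + (orbit h (zero2 h + 1) + a2 / \<mu>) * X"
    using order by (subst orbit_flow4) (auto simp: flow_def X[symmetric] algebra_simps)
  also have "\<dots> = - a2 / \<mu> + 2 * a2 / \<mu> * X + (orbit h p - a2 / \<mu>) * (exp (- \<mu> * (zero2 h + 1 - p)) * X)"
    unfolding q by (simp add: algebra_simps)
  also have "\<dots> = - a2 / \<mu> + 2 * a2 / \<mu> * X + (a1 - a2) / \<mu> * P - a1 / \<mu> * (exp (\<mu> * (zero2 h - p)) * P)"
    unfolding P2 p by (simp add: algebra_simps diff_divide_distrib)
  also have "\<dots> = (2 * a2 - a1 * exp (- \<mu>)) / \<mu> * X + (a1 - a2) / \<mu> * P - a2 / \<mu>"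
    unfolding P1 by (simp add: algebra_simps diff_divide_distrib)
  also have "\<dots> = return h"
  proof -
    have "(2 * a2 - a1 * e) / \<mu> * (E * D * ((\<mu> * h + a1) / a1))
      = (2 * (a2 / a1) - e) * D * E * h + (2 * a2 - a1 * e) / \<mu> * D * E" for e D E
      using pos by (simp add: field_simps)
    then show ?thesis
      by (simp add: return_def X_def P_def)
  qed
  finally show ?thesis .
qed

lemma orbit_pos_before: "t < zero1 h \<Longrightarrow> orbit h t > 0"
  using pos by (simp add: orbit_eq1)

lemma orbit_neg:
  assumes "zero1 h < t" "t < zero2 h"
  shows "orbit h t < 0"
proof (cases "t \<le> zero1 h + 1")
  case True
  then show ?thesis
    unfolding orbit_eq1[OF True] using pos assms
    by (intro mult_pos_neg divide_pos_pos) (auto simp: mult_pos_neg)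
next
  case False
  then have "orbit h t = a1 / \<mu> * (1 - exp (\<mu> * (zero2 h - t)))"
    using order assms by (intro orbit_eq2) auto
  also have "\<dots> < 0"
    using pos assms by (intro mult_pos_neg divide_pos_pos) auto
  finally show ?thesis .
qed

lemma orbit_zero: "orbit h (zero1 h) = 0" "orbit h (zero2 h) = 0"
  using order by (simp_all add: orbit_eq1 orbit_eq2)

text \<open>Up to \<open>p\<close> the explicit formula shows the sign, and then positive forcing
  preserves it. The last arc decreases, so it is bounded below by its end value
  \<open>return h\<close>.\<close>

lemma orbit_pos_after:
  assumes "zero2 h < t" "t \<le> T"
  shows "orbit h t > 0"
proof -
  have mid: "orbit h t > 0" if "p \<le> t" "t \<le> zero2 h + 1" for t
    unfolding orbit_flow3[OF that] using that pos orbit_p_pos by (intro flow_pos) auto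
  consider "t \<le> p" | "p \<le> t" "t \<le> zero2 h + 1" | "zero2 h + 1 \<le> t"
    by linarith
  then show ?thesis
  proof cases
    case 1
    then show ?thesis
      using pos order assms by (simp add: orbit_eq2 mult_pos_neg)
  next
    case 2
    then show ?thesis
      by (rule mid)
  next
    case 3
    have "0 < orbit h T"
      using adm by (simp add: orbit_T admissible_def)
    also have "\<dots> \<le> orbit h t"
      unfolding orbit_flow4[OF 3] orbit_flow4[OF less_imp_le[OF order(5)]]
      using pos order assms mid[of "zero2 h + 1"] by (intro flow_antimono) auto
    finally show ?thesis .
  qed
qed

lemma orbit_eq_0_iff:
  assumes "0 \<le> t" "t \<le> T"
  shows "orbit h t = 0 \<longleftrightarrow> t = zero1 h \<or> t = zero2 h"
  using orbit_pos_before[of t] orbit_neg[of t] orbit_pos_after[of t] orbit_zero assms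
  by (metis less_irrefl linorder_less_linear)

lemma continuous_on_orbit: "continuous_on S (orbit h)"
  unfolding orbit_def flow_def using pos by (intro continuous_intros) auto

text \<open>The forcing is split into the value of \<open>a\<close> and that of the delayed
  feedback, which flips one unit after each zero.\<close>

lemma has_real_derivative_orbit:
  assumes "0 < t" "t < T" "t \<notin> {p, zero1 h + 1, zero2 h + 1}"
  shows "(orbit h has_real_derivative
    (- \<mu> * orbit h t + (if t < p then a1 else a2) *
      (if t < zero1 h + 1 then - 1 else if t < zero2 h + 1 then 1 else - 1))) (at t)"
proof -
  have piece: "(orbit h has_real_derivative (- \<mu> * orbit h t + k)) (at t)"
    if "open S" "t \<in> S" "\<And>s. s \<in> S \<Longrightarrow> orbit h s = flow k v (s - c)" for S k v c
    using has_real_derivative_flow[of k v c t] that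
    by (metis (no_types, lifting) has_field_derivative_transform_within_open)
  consider "t < zero1 h + 1" | "zero1 h + 1 < t" "t < p" | "p < t" "t < zero2 h + 1" | "zero2 h + 1 < t"
    using assms by auto linarith
  then show ?thesis
  proof cases
    case 1
    then have "(orbit h has_real_derivative (- \<mu> * orbit h t + - a1)) (at t)"
      by (intro piece[of "{..<zero1 h + 1}" _ h 0]) (auto simp: orbit_flow1)
    then show ?thesis
      using 1 order by simp
  next
    case 2
    then have "(orbit h has_real_derivative (- \<mu> * orbit h t + a1)) (at t)"
      by (intro piece[OF _ _ orbit_flow2, of "{zero1 h + 1<..<p}"]) auto
    then show ?thesis
      using 2 order by simp
  next
    case 3
    then have "(orbit h has_real_derivative (- \<mu> * orbit h t + a2)) (at t)"
      by (intro piece[OF _ _ orbit_flow3, of "{p<..<zero2 h + 1}"]) auto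
    then show ?thesis
      using 3 order by simp
  next
    case 4
    then have "(orbit h has_real_derivative (- \<mu> * orbit h t + - a2)) (at t)"
      by (intro piece[OF _ _ orbit_flow4, of "{zero2 h + 1<..}"]) auto
    then show ?thesis
      using 4 order by simp
  qed
qed

end

section \<open>Concatenating periods\<close>

lemma T_pos: "T > 0"
  using switch by simp

lemma a_shift: "a (t + real k * T) = a t"
proof (induction k)
  case (Suc k)
  then show ?case
    using periodic[of "t + real k * T"] by (simp add: algebra_simps)
qed simp

lemma isCont_a:
  assumes "0 < s" "s < T" "s \<noteq> p"
  shows "isCont a (real k * T + s)"
proof -
  let ?S = "if s < p then {0<..<p} else {p<..<T}"
  have "\<forall>\<^sub>F u in nhds s. u \<in> ?S"
    using assms by (intro eventually_nhds_in_open) auto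
  then have "\<forall>\<^sub>F u in nhds s. a u = a s"
    by eventually_elim (use assms first second in \<open>auto split: if_splits\<close>)
  then have "isCont a s"
    using isCont_cong[of a "\<lambda>_. a s" s] by simp
  then have "isCont (\<lambda>u. a (u - real k * T)) (real k * T + s)"
    by (intro isCont_o2[of _ "\<lambda>u. u - real k * T" a]) auto
  moreover have "a (u - real k * T) = a u" for u
    using a_shift[of "u - real k * T" k] by simp
  ultimately show ?thesis
    by simp
qed

lemma period_decomposition:
  assumes "t \<ge> 0"
  obtains k s where "t = real k * T + s" "0 \<le> s" "s < T"
proof
  show "t = real (nat \<lfloor>t / T\<rfloor>) * T + (t - of_int \<lfloor>t / T\<rfloor> * T)"
    using assms T_pos by simp
  show "0 \<le> t - of_int \<lfloor>t / T\<rfloor> * T" "t - of_int \<lfloor>t / T\<rfloor> * T < T"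
    using floor_divide_lower[OF T_pos, of t] floor_divide_upper[OF T_pos, of t]
    by (simp_all add: algebra_simps)
qed

text \<open>\<open>H k\<close> is meant as the value at time \<open>k * T\<close>. The offsets 0 and
  \<open>p\<close> are switches of \<open>a\<close>; at the other two the delayed value
  vanishes.\<close>

definition breaks :: "(nat \<Rightarrow> real) \<Rightarrow> real set" where
  "breaks H = (\<Union>k. (+) (real k * T) ` {0, p, zero1 (H k) + 1, zero2 (H k) + 1})"

lemma finite_breaks:
  assumes adm: "\<And>k. admissible (H k)"
  shows "finite (breaks H \<inter> {0..c})"
proof -
  obtain n where "c / T \<le> real n"
    using real_arch_simple by blast
  then have c: "c \<le> real n * T"
    using T_pos by (simp add: field_simps)
  have "breaks H \<inter> {0..c} \<subseteq> (\<Union>k\<in>{..n}. (+) (real k * T) ` {0, p, zero1 (H k) + 1, zero2 (H k) + 1})"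
  proof
    fix t assume t: "t \<in> breaks H \<inter> {0..c}"
    then obtain k where "t \<in> (+) (real k * T) ` {0, p, zero1 (H k) + 1, zero2 (H k) + 1}"
      unfolding breaks_def by blast
    then obtain s where ks: "t = real k * T + s" "s \<in> {0, p, zero1 (H k) + 1, zero2 (H k) + 1}"
      by (rule imageE)
    then have "0 \<le> s"
      using order[OF adm, of k] switch by auto
    then have "real k * T \<le> real n * T"
      using ks t c by simp
    then have "k \<le> n"
      using T_pos by simp
    then show "t \<in> (\<Union>k\<in>{..n}. (+) (real k * T) ` {0, p, zero1 (H k) + 1, zero2 (H k) + 1})"
      using ks by auto
  qed
  then show ?thesis
    by (rule finite_subset) auto
qed

text \<open>The floor selects the period containing \<open>t\<close>, and at a positive multiple of
  \<open>T\<close> the arc that starts there.\<close>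

definition glue :: "(real \<Rightarrow> real) \<Rightarrow> (nat \<Rightarrow> real) \<Rightarrow> real \<Rightarrow> real" where
  "glue \<phi> H t =
     (if t \<le> 0 then \<phi> t else orbit (H (nat \<lfloor>t / T\<rfloor>)) (t - of_int \<lfloor>t / T\<rfloor> * T))"

section \<open>Gluing orbits along the iterates of the period map\<close>

context
  fixes \<phi> :: "real \<Rightarrow> real" and H :: "nat \<Rightarrow> real"
  assumes init_cont: "continuous_on {-1..0} \<phi>"
    and init_pos: "\<And>s. s \<in> {-1..0} \<Longrightarrow> \<phi> s > 0"
    and H_0: "H 0 = \<phi> 0"
    and H_Suc: "\<And>k. H (Suc k) = return (H k)"
    and adm: "\<And>k. admissible (H k)"
begin

lemma glue_init: "s \<le> 0 \<Longrightarrow> glue \<phi> H s = \<phi> s"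
  by (simp add: glue_def)

text \<open>Including \<open>s = T\<close> lets neighbouring pieces share an endpoint, as continuity
  requires. They match there by \<open>orbit_T\<close> and \<open>H_Suc\<close>.\<close>

lemma glue_period:
  assumes "0 \<le> s" "s \<le> T"
  shows "glue \<phi> H (real k * T + s) = orbit (H k) s"
proof -
  have half_open: "glue \<phi> H (real k * T + s) = orbit (H k) s" if s: "0 \<le> s" "s < T" for k s
  proof (cases "real k * T + s \<le> 0")
    case True
    moreover have "0 \<le> real k * T"
      using T_pos by simp
    ultimately have "real k * T = 0" "s = 0"
      using s by linarith+
    then show ?thesis
      using T_pos H_0 orbit_0[OF adm, of 0] by (simp add: glue_def)
  next
    case False
    have "\<lfloor>(real k * T + s) / T\<rfloor> = int k"
      using s T_pos by (intro floor_unique) (simp_all add: field_simps)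
    then show ?thesis
      using False by (simp add: glue_def)
  qed
  show ?thesis
  proof (cases "s < T")
    case True
    then show ?thesis
      using half_open assms by simp
  next
    case False
    then have "s = T"
      using assms by simp
    then have eq: "real k * T + s = real (Suc k) * T + 0"
      by (simp add: algebra_simps)
    have "glue \<phi> H (real k * T + s) = orbit (H (Suc k)) 0"
      unfolding eq by (rule half_open[OF order_refl T_pos])
    then show ?thesis
      using H_Suc \<open>s = T\<close> orbit_0[OF adm, of "Suc k"] orbit_T[OF adm, of k] by simp
  qed
qed

text \<open>Closed pieces are pasted one period at a time; continuity on the half-line is then a
  local matter.\<close>

lemma continuous_on_glue: "continuous_on {-1..} (glue \<phi> H)"
proof -
  have upto: "continuous_on {-1..real n * T} (glue \<phi> H)" for n
  proof (induction n)
    case 0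
    have "continuous_on {-1..0} (glue \<phi> H) \<longleftrightarrow> continuous_on {-1..0} \<phi>"
      by (intro continuous_on_cong) (auto simp: glue_init)
    then show ?case
      using init_cont by simp
  next
    case (Suc n)
    have "continuous_on {real n * T..real (Suc n) * T} (\<lambda>t. orbit (H n) (t - real n * T))"
      by (intro continuous_on_compose2[OF continuous_on_orbit[OF adm, of UNIV]] continuous_intros) auto
    moreover have "glue \<phi> H t = orbit (H n) (t - real n * T)"
      if "t \<in> {real n * T..real (Suc n) * T}" for t
      using that glue_period[of "t - real n * T" n] by (auto simp: algebra_simps)
    then have "continuous_on {real n * T..real (Suc n) * T} (glue \<phi> H) \<longleftrightarrow>
        continuous_on {real n * T..real (Suc n) * T} (\<lambda>t. orbit (H n) (t - real n * T))"
      by (intro continuous_on_cong refl)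
    ultimately have "continuous_on {real n * T..real (Suc n) * T} (glue \<phi> H)"
      by simp
    then have "continuous_on ({-1..real n * T} \<union> {real n * T..real (Suc n) * T}) (glue \<phi> H)"
      using Suc by (intro continuous_on_closed_Un) auto
    moreover have "-1 \<le> real n * T" "real n * T \<le> real (Suc n) * T"
      using T_pos order_trans[of "-1" 0 "real n * T"] by (auto simp: algebra_simps)
    ultimately show ?case
      by (simp add: ivl_disj_un_two_touch)
  qed
  show ?thesis
    unfolding continuous_on_eq_continuous_within
  proof
    fix t :: real assume "t \<in> {-1..}"
    obtain n where "t / T < real n"
      using reals_Archimedean2 by blast
    then have n: "t < real n * T"
      using T_pos by (simp add: field_simps)
    have "continuous (at t within {-1..real n * T}) (glue \<phi> H)"
      using upto[of n] n \<open>t \<in> {-1..}\<close> by (simp add: continuous_on_eq_continuous_within)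
    moreover have "at t within {-1..} = at t within {-1..real n * T}"
      using n by (intro at_within_nhd[of t "{..<real n * T}"]) auto
    ultimately show "continuous (at t within {-1..}) (glue \<phi> H)"
      by simp
  qed
qed

text \<open>For \<open>s < 1\<close> the delay reaches into the initial function or into the last
  unit of the previous period. Both are positive, the latter because
  \<open>zero2 (H j) + 1 < T\<close>. Otherwise it stays within the current orbit.\<close>

lemma sgn_glue_delayed:
  assumes s: "0 < s" "s < T" "s \<notin> {zero1 (H k) + 1, zero2 (H k) + 1}"
  shows "sgn (glue \<phi> H (real k * T + s - 1)) =
    (if s < zero1 (H k) + 1 then 1 else if s < zero2 (H k) + 1 then - 1 else 1)"
proof (cases "s < 1")
  case True
  then have early: "s < zero1 (H k) + 1"
    using order[OF adm, of k] by simp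
  have "glue \<phi> H (real k * T + s - 1) > 0"
  proof (cases k)
    case 0
    then show ?thesis
      using True s init_pos by (simp add: glue_init)
  next
    case (Suc j)
    have eq: "real k * T + s - 1 = real j * T + (T + s - 1)"
      using Suc by (simp add: algebra_simps)
    have "zero2 (H j) < T + s - 1" "0 \<le> T + s - 1" "T + s - 1 \<le> T"
      using order[OF adm, of j] s True by auto
    then show ?thesis
      unfolding eq using glue_period[of "T + s - 1" j] orbit_pos_after[OF adm, of j "T + s - 1"] by simp
  qed
  with early show ?thesis
    by simp
next
  case False
  then have eq: "glue \<phi> H (real k * T + s - 1) = orbit (H k) (s - 1)"
    using glue_period[of "s - 1" k] s by (simp add: algebra_simps)
  show ?thesis
    unfolding eq
    using orbit_pos_before[OF adm, of "s - 1" k] orbit_neg[OF adm, of k "s - 1"]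
      orbit_pos_after[OF adm, of k "s - 1"] s False
    by auto
qed

lemma off_breaks:
  assumes "t > 0" "t \<notin> breaks H"
  obtains k s where "t = real k * T + s" "0 < s" "s < T"
    "s \<notin> {p, zero1 (H k) + 1, zero2 (H k) + 1}"
proof -
  obtain k s where ks: "t = real k * T + s" "0 \<le> s" "s < T"
    using period_decomposition assms(1) less_imp_le by metis
  moreover have "s \<notin> {0, p, zero1 (H k) + 1, zero2 (H k) + 1}"
    using assms(2) ks by (auto simp: breaks_def)
  ultimately show ?thesis
    using that[of k s] by auto
qed

lemma glue_regular:
  assumes "t > 0" "t \<notin> breaks H"
  shows "isCont a t \<and> glue \<phi> H (t - 1) \<noteq> 0"
proof -
  obtain k s where ks: "t = real k * T + s" "0 < s" "s < T"
    "s \<notin> {p, zero1 (H k) + 1, zero2 (H k) + 1}"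
    using off_breaks assms by blast
  then have "sgn (glue \<phi> H (t - 1)) \<noteq> 0"
    using sgn_glue_delayed[of s k] by auto
  then show ?thesis
    using isCont_a[of s k] ks by auto
qed

text \<open>Off \<open>breaks H\<close> the two factors of the orbit's forcing are
  \<open>a t\<close> and the delayed feedback. The break points are left to
  \<open>dde_forward_solutionI\<close>.\<close>

lemma glue_solution: "dde_forward_solution \<mu> a \<phi> (glue \<phi> H)"
proof (rule dde_forward_solutionI)
  fix t :: real
  assume t: "t > 0" "t \<notin> breaks H"
  then obtain k s where ks: "t = real k * T + s" "0 < s" "s < T"
    "s \<notin> {p, zero1 (H k) + 1, zero2 (H k) + 1}"
    using off_breaks by blast
  let ?c = "(if s < p then a1 else a2) *
    (if s < zero1 (H k) + 1 then - 1 else if s < zero2 (H k) + 1 then 1 else - 1)"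
  have glue: "glue \<phi> H u = orbit (H k) (u + - (real k * T))"
    if "u \<in> {real k * T<..<real k * T + T}" for u
    using glue_period[of "u - real k * T" k] that by auto
  have "(orbit (H k) has_real_derivative (- \<mu> * orbit (H k) s + ?c)) (at (t + - (real k * T)))"
    using has_real_derivative_orbit[OF adm, of s k] ks by simp
  then have "((\<lambda>u. orbit (H k) (u + - (real k * T))) has_real_derivative
      (- \<mu> * orbit (H k) s + ?c)) (at t)"
    by (simp only: DERIV_shift)
  then have "(glue \<phi> H has_real_derivative (- \<mu> * orbit (H k) s + ?c)) (at t)"
    by (rule has_field_derivative_transform_within_open[of _ _ _ "{real k * T<..<real k * T + T}"])
      (use ks glue in auto)
  moreover have "glue \<phi> H t = orbit (H k) s"
    using glue_period[of s k] ks by simp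
  moreover have "a t = (if s < p then a1 else a2)"
    using a_shift[of s k] first second ks by (auto simp: add.commute)
  moreover have "feedback (glue \<phi> H (t - 1)) =
      (if s < zero1 (H k) + 1 then - 1 else if s < zero2 (H k) + 1 then 1 else - 1)"
    using sgn_glue_delayed[of s k] ks by (simp add: feedback_def)
  ultimately show "(glue \<phi> H has_real_derivative
      (- \<mu> * glue \<phi> H t + a t * feedback (glue \<phi> H (t - 1)))) (at t)"
    by simp
next
  show "finite (breaks H \<inter> {0..c})" for c
    using adm by (rule finite_breaks)
next
  show "continuous_on {-1..} (glue \<phi> H)"
    by (rule continuous_on_glue)
next
  show "glue \<phi> H s = \<phi> s" if "s \<in> {-1..0}" for s
    using that by (intro glue_init) simp
qed

lemma glue_unique:
  assumes "dde_forward_solution \<mu> a \<phi> z" "t \<ge> 0"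
  shows "z t = glue \<phi> H t"
proof (rule dde_forward_solution_unique[OF glue_solution assms(1), where E = "breaks H"])
  show "finite (breaks H \<inter> {0..c})" for c
    using adm by (rule finite_breaks)
next
  show "isCont a t \<and> glue \<phi> H (t - 1) \<noteq> 0" if "t > 0" "t \<notin> breaks H" for t
    using that by (rule glue_regular)
qed (use assms(2) in auto)

end

section \<open>The periodic solution and its stability\<close>

text \<open>The multiplier \<open>m\<close> of the period map.\<close>

definition slope :: real where
  "slope = (2 * (a2 / a1) - exp (- \<mu>)) * (2 - exp (- \<mu>)) * exp (- \<mu> * (T - 2))"

lemma return_affine: "return u = return v + slope * (u - v)"
  by (simp add: return_def slope_def right_diff_distrib)

lemma isCont_zero1: "h > 0 \<Longrightarrow> isCont zero1 h"
  unfolding zero1_def using pos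
  by (intro continuous_intros) (auto simp: add_pos_pos less_imp_neq[symmetric])

text \<open>Admissibility consists of strict inequalities between functions continuous at
  \<open>h\<close>.\<close>

lemma admissible_near:
  assumes "admissible h"
  obtains r where "r > 0" "\<And>u. \<bar>u - h\<bar> < r \<Longrightarrow> admissible u"
proof -
  have "isCont zero2 h"
    unfolding zero2_def using isCont_zero1 h_pos[OF assms] pos by (intro continuous_intros) auto
  then have zero2: "(zero2 \<longlongrightarrow> zero2 h) (nhds h)"
    by (simp add: isCont_def tendsto_at_iff_tendsto_nhds)
  have "isCont return h"
    unfolding return_def by (intro continuous_intros)
  then have return: "(return \<longlongrightarrow> return h) (nhds h)"
    by (simp add: isCont_def tendsto_at_iff_tendsto_nhds)
  have "\<forall>\<^sub>F u in nhds h. 0 < u \<and> zero2 u < p \<and> p - 1 < zero2 u \<and> zero2 u < T - 1 \<and> 0 < return u"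
    using assms unfolding admissible_def
    by (intro eventually_conj order_tendstoD[OF zero2] order_tendstoD[OF return]
        order_tendstoD[OF filterlim_ident]) auto
  then have "\<forall>\<^sub>F u in nhds h. admissible u"
    by eventually_elim (auto simp: admissible_def)
  then show ?thesis
    using that by (auto simp: eventually_nhds_metric dist_real_def)
qed

lemma orbit_uniform:
  assumes "h > 0" "e > 0"
  obtains d where "d > 0"
    "\<And>u t. \<bar>u - h\<bar> < d \<Longrightarrow> 0 \<le> t \<Longrightarrow> t \<le> T \<Longrightarrow> \<bar>orbit u t - orbit h t\<bar> < e"
proof -
  \<comment> \<open>A compact rectangle on which the argument of the logarithm in
    \<open>zero1\<close> stays positive.\<close>
  let ?K = "{h / 2..3 * h / 2} \<times> {0..T}"
  let ?f = "\<lambda>w. orbit (fst w) (snd w)"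
  have pos': "\<mu> * fst w + a1 > 0" if "w \<in> ?K" for w
    using that assms pos by (auto intro!: add_pos_pos mult_pos_pos)
  have "continuous_on ?K (\<lambda>w. zero1 (fst w))"
    unfolding zero1_def using pos pos' by (intro continuous_intros) (auto dest: pos' simp: less_imp_neq[symmetric])
  then have "continuous_on ?K ?f"
    unfolding orbit_def flow_def zero2_def using pos by (intro continuous_intros) auto
  then have "uniformly_continuous_on ?K ?f"
    by (intro compact_uniformly_continuous compact_Times) auto
  then obtain d where d: "d > 0"
    "\<And>w w'. w \<in> ?K \<Longrightarrow> w' \<in> ?K \<Longrightarrow> dist w' w < d \<Longrightarrow> dist (?f w') (?f w) < e"
    unfolding uniformly_continuous_on_def using assms(2) by metis
  show ?thesis
  proof (rule that[of "min d (h / 2)"])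
    fix u t assume u: "\<bar>u - h\<bar> < min d (h / 2)" and t: "0 \<le> t" "t \<le> T"
    then have "h / 2 \<le> u" "u \<le> 3 * h / 2"
      by (auto simp: abs_if split: if_splits)
    then show "\<bar>orbit u t - orbit h t\<bar> < e"
      using d(2)[of "(h, t)" "(u, t)"] u t assms(1) by (simp add: dist_Pair_Pair dist_real_def)
  qed (use d assms in auto)
qed

text \<open>Periodic by construction for every \<open>h\<close>; the pieces fit together at
  multiples of \<open>T\<close> when \<open>return h = h\<close>.\<close>

definition extension :: "real \<Rightarrow> real \<Rightarrow> real" where
  "extension h t = orbit h (t - of_int \<lfloor>t / T\<rfloor> * T)"

lemma extension_periodic: "extension h (t + T) = extension h t"
proof -
  have "(t + T) / T = t / T + 1"
    using T_pos by (simp add: add_divide_distrib)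
  then show ?thesis
    by (simp add: extension_def algebra_simps)
qed

lemma extension_shift: "extension h (t + real n * T) = extension h t"
proof (induction n)
  case (Suc n)
  then show ?case
    using extension_periodic[of h "t + real n * T"] by (simp add: algebra_simps)
qed simp

section \<open>The orbit of an admissible fixed point\<close>

context
  fixes h assumes adm: "admissible h" and fixed: "return h = h"
begin

lemma extension_eq_orbit:
  assumes "0 \<le> t" "t \<le> T"
  shows "extension h t = orbit h t"
proof (cases "t = T")
  case True
  then show ?thesis
    using T_pos orbit_0[OF adm] orbit_T[OF adm] fixed by (simp add: extension_def)
next
  case False
  have "\<lfloor>t / T\<rfloor> = 0"
    using assms False T_pos by (intro floor_unique) (auto simp: field_simps)
  then show ?thesis
    by (simp add: extension_def)
qed

text \<open>The sequence of values is constant because \<open>h\<close> is fixed by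
  \<open>return\<close>. On the initial interval this function is constant, unlike the periodic
  solution; the two agree for positive times.\<close>

abbreviation forward :: "real \<Rightarrow> real" where
  "forward \<equiv> glue (\<lambda>_. h) (\<lambda>_. h)"

lemma forward_solution: "dde_forward_solution \<mu> a (\<lambda>_. h) forward"
  using adm fixed h_pos[OF adm] by (intro glue_solution) auto

lemma forward_unique:
  assumes "dde_forward_solution \<mu> a (\<lambda>_. h) z" "t \<ge> - 1"
  shows "z t = forward t"
proof (cases "t \<le> 0")
  case True
  then show ?thesis
    using assms by (simp add: glue_def dde_forward_solution_def)
next
  case False
  then show ?thesis
    using adm fixed h_pos[OF adm] by (intro glue_unique[OF _ _ _ _ _ assms(1)]) auto
qed

lemma forward_eq_extension: "t > 0 \<Longrightarrow> forward t = extension h t"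
  by (simp add: glue_def extension_def)

text \<open>Periodicity moves any time to a positive one, where the extension coincides with
  \<open>forward\<close> and inherits its equation.\<close>

lemma extension_solution: "dde_solution \<mu> a (extension h)"
proof -
  have shifted: "isCont (extension h) t \<and> (isCont a t \<and> extension h (t - 1) \<noteq> 0 \<longrightarrow>
      (extension h has_real_derivative
        (- \<mu> * extension h t + a t * feedback (extension h (t - 1)))) (at t))" for t
  proof -
    \<comment> \<open>Enough periods are added to make even the delayed time positive.\<close>
    obtain n where "(1 - t) / T < real n"
      using reals_Archimedean2 by blast
    then have n: "t - 1 + real n * T > 0"
      using T_pos by (simp add: field_simps)
    have ext: "extension h u = forward (u + real n * T)" if "u \<in> {- real n * T<..}" for u
      using that forward_eq_extension[of "u + real n * T"] by (simp add: extension_shift)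
    have near: "\<forall>\<^sub>F u in nhds t. extension h u = forward (u + real n * T)"
      using n by (intro eventually_mono[OF eventually_nhds_in_open[of "{- real n * T<..}" t] ext]) auto
    have "continuous_on {-1..} forward"
      using forward_solution by (simp add: dde_forward_solution_def)
    then have "isCont forward (t + real n * T)"
      using n by (intro continuous_on_interior[where S = "{-1..}"]) auto
    then have "isCont (\<lambda>u. forward (u + real n * T)) t"
      by (intro isCont_o2[of _ "\<lambda>u. u + real n * T" forward]) auto
    then have "isCont (extension h) t"
      using isCont_cong[OF near] by simp
    moreover have "(extension h has_real_derivative
        (- \<mu> * extension h t + a t * feedback (extension h (t - 1)))) (at t)"
      if "isCont a t" "extension h (t - 1) \<noteq> 0"
    proof -
      have "isCont (\<lambda>u. a (u - real n * T)) (t + real n * T)"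
        using that(1) by (intro isCont_o2[of _ "\<lambda>u. u - real n * T" a]) auto
      moreover have "a (u - real n * T) = a u" for u
        using a_shift[of "u - real n * T" n] by simp
      ultimately have "isCont a (t + real n * T)"
        by simp
      moreover have now: "extension h t = forward (t + real n * T)"
        and delayed: "extension h (t - 1) = forward (t + real n * T - 1)"
        using ext[of t] ext[of "t - 1"] n by (simp_all add: algebra_simps)
      ultimately have "(forward has_real_derivative (- \<mu> * extension h t +
          a (t + real n * T) * feedback (extension h (t - 1)))) (at (t + real n * T))"
        using forward_solution n that by (simp add: dde_forward_solution_def)
      then have "((\<lambda>u. forward (u + real n * T)) has_real_derivative
          (- \<mu> * extension h t + a t * feedback (extension h (t - 1)))) (at t)"
        by (simp add: DERIV_shift a_shift)
      then show ?thesis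
        using DERIV_cong_ev[OF refl near refl] by simp
    qed
    ultimately show ?thesis
      by simp
  qed
  then show ?thesis
    by (simp add: dde_solution_def continuous_on_eq_continuous_at)
qed

lemma extension_slowly_oscillating: "slowly_oscillating (extension h)"
proof (rule slowly_oscillatingI[of T "extension h" "zero1 h" "zero2 h", OF T_pos extension_periodic])
  show "extension h t = 0 \<longleftrightarrow> t = zero1 h \<or> t = zero2 h" if "0 \<le> t" "t < T" for t
    using that by (simp add: extension_eq_orbit orbit_eq_0_iff[OF adm])
qed (use order[OF adm] in auto)

lemma extension_initial:
  assumes "s \<in> {-1..0}"
  shows "extension h s = orbit h (T + s)"
  using extension_periodic[of h s] extension_eq_orbit[of "T + s"] order[OF adm] assms
  by (simp add: add.commute)

lemma extension_initial_pos: "s \<in> {-1..0} \<Longrightarrow> extension h s > 0"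
  using order[OF adm] by (simp add: extension_initial orbit_pos_after[OF adm])

text \<open>Nearby initial states are positive, so a perturbed solution is a glued one. Its values
  at multiples of \<open>T\<close> never move away from \<open>h\<close>, and
  \<open>orbit_uniform\<close> controls the arcs between.\<close>

lemma extension_stable:
  assumes contraction: "\<bar>slope\<bar> < 1"
  shows "lyapunov_stable \<mu> a (extension h)"
  unfolding lyapunov_stable_def
proof (intro allI impI)
  fix e :: real assume "e > 0"
  have cont: "continuous_on S (extension h)" for S
    using extension_solution by (auto simp: dde_solution_def intro: continuous_on_subset)
  \<comment> \<open>The minimum over the compact initial interval gives a positive margin: any state
    closer than it is positive.\<close>
  obtain s\<^sub>0 where s\<^sub>0: "s\<^sub>0 \<in> {-1..0}" "\<And>s. s \<in> {-1..0} \<Longrightarrow> extension h s\<^sub>0 \<le> extension h s"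
    using continuous_attains_inf[OF compact_Icc[of "-1::real" 0] _ cont] by auto
  define \<eta> where "\<eta> = extension h s\<^sub>0"
  have \<eta>: "\<eta> > 0" "\<And>s. s \<in> {-1..0} \<Longrightarrow> \<eta> \<le> extension h s"
    using s\<^sub>0 extension_initial_pos by (simp_all add: \<eta>_def)
  obtain r where r: "r > 0" "\<And>u. \<bar>u - h\<bar> < r \<Longrightarrow> admissible u"
    using admissible_near[OF adm] by metis
  obtain d where d: "d > 0"
    "\<And>u t. \<bar>u - h\<bar> < d \<Longrightarrow> 0 \<le> t \<Longrightarrow> t \<le> T \<Longrightarrow> \<bar>orbit u t - orbit h t\<bar> < e / 2"
    using orbit_uniform[OF h_pos[OF adm], of "e / 2"] \<open>e > 0\<close> by (metis half_gt_zero)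
  \<comment> \<open>The bounds secure, in turn, a positive initial state, admissible iterates, close
    arcs, and closeness on the initial interval. Using \<open>e / 2\<close> keeps the supremum
    strictly below \<open>e\<close>.\<close>
  define \<delta> where "\<delta> = min (min \<eta> r) (min d (e / 2))"
  have "(\<exists>z. dde_forward_solution \<mu> a \<phi> z) \<and>
      (\<forall>z. dde_forward_solution \<mu> a \<phi> z \<longrightarrow>
        (\<forall>t\<ge>0. state_dist (state z t) (state (extension h) t) < e))"
    if \<phi>: "continuous_on {-1..0} \<phi>" "state_dist \<phi> (state (extension h) 0) < \<delta>" for \<phi>
  proof -
    have close: "\<bar>\<phi> s - extension h s\<bar> < \<delta>" if "s \<in> {-1..0}" for s
      using le_state_dist[OF \<phi>(1) _ that, of "state (extension h) 0"] \<phi>(2) cont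
      by (simp add: state_def)
    have pos\<phi>: "\<phi> s > 0" if "s \<in> {-1..0}" for s
      using close[OF that] \<eta>(2)[OF that] by (simp add: \<delta>_def abs_less_iff)
    have "extension h 0 = h"
      using T_pos by (simp add: extension_eq_orbit orbit_0[OF adm])
    then have "\<bar>\<phi> 0 - h\<bar> < \<delta>"
      using close[of 0] by simp
    \<comment> \<open>The iterates of an affine map in closed form around its fixed point.\<close>
    define H where "H k = h + slope ^ k * (\<phi> 0 - h)" for k
    have H_near: "\<bar>H k - h\<bar> < \<delta>" for k
    proof -
      have "\<bar>slope ^ k\<bar> \<le> 1"
        using contraction by (simp add: power_abs power_le_one)
      then have "\<bar>H k - h\<bar> \<le> \<bar>\<phi> 0 - h\<bar>"
        by (simp add: H_def abs_mult mult_left_le_one_le)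
      with \<open>\<bar>\<phi> 0 - h\<bar> < \<delta>\<close> show ?thesis
        by simp
    qed
    have H_0: "H 0 = \<phi> 0"
      by (simp add: H_def)
    have H_Suc: "H (Suc k) = return (H k)" for k
      using return_affine[of "H k" h] fixed by (simp add: H_def)
    have admH: "admissible (H k)" for k
      using H_near[of k] by (intro r) (simp add: \<delta>_def)
    have "dde_forward_solution \<mu> a \<phi> (glue \<phi> H)"
      using \<phi>(1) pos\<phi> H_0 H_Suc admH by (rule glue_solution)
    moreover have "state_dist (state z t) (state (extension h) t) < e"
      if z: "dde_forward_solution \<mu> a \<phi> z" and "t \<ge> 0" for z t
    proof -
      have near: "\<bar>z u - extension h u\<bar> \<le> e / 2" if "u \<ge> -1" for u
      proof (cases "u \<le> 0")
        case True
        then show ?thesis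
          using z close[of u] that by (simp add: dde_forward_solution_def \<delta>_def)
      next
        case False
        then obtain k s where u: "u = real k * T + s" "0 \<le> s" "s < T"
          using period_decomposition by (metis less_eq_real_def not_le)
        have "z u = glue \<phi> H u"
          using False glue_unique[OF \<phi>(1) pos\<phi> H_0 H_Suc admH z] by simp
        also have "\<dots> = orbit (H k) s"
          unfolding u(1) using u by (intro glue_period[OF \<phi>(1) pos\<phi> H_0 H_Suc admH]) auto
        finally have "z u = orbit (H k) s" .
        moreover have "extension h u = orbit h s"
          using u extension_shift[of h s k] by (simp add: extension_eq_orbit add.commute)
        ultimately show ?thesis
          using d(2)[of "H k" s] H_near[of k] u by (simp add: \<delta>_def)
      qed
      have "state_dist (state z t) (state (extension h) t) \<le> e / 2"
        using near \<open>t \<ge> 0\<close> by (intro state_dist_le) (auto simp: state_def)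
      with \<open>e > 0\<close> show ?thesis
        by simp
    qed
    ultimately show ?thesis
      by blast
  qed
  moreover have "\<delta> > 0"
    using \<eta> r d \<open>e > 0\<close> by (simp add: \<delta>_def)
  ultimately show "\<exists>\<delta>>0. \<forall>\<phi>. continuous_on {-1..0} \<phi> \<and> state_dist \<phi> (state (extension h) 0) < \<delta> \<longrightarrow>
      (\<exists>z. dde_forward_solution \<mu> a \<phi> z) \<and>
      (\<forall>z. dde_forward_solution \<mu> a \<phi> z \<longrightarrow>
        (\<forall>t\<ge>0. state_dist (state z t) (state (extension h) t) < e))"
    by blast
qed

text \<open>Since \<open>T > 1\<close>, the time \<open>T + s\<close> is positive, where
  \<open>forward\<close> and the extension agree.\<close>

lemma state_extension:
  assumes "s \<in> {-1..0}"
  shows "state (extension h) 0 s = forward (T + s)"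
  using assms order[OF adm] extension_periodic[of h s]
  by (simp add: state_def forward_eq_extension add.commute)

end

end

theorem corollary2p2:
  fixes \<mu> a\<^sub>1 a\<^sub>2 p\<^sub>1 p\<^sub>2 T m b h t\<^sub>1 t\<^sub>2 :: real
    and a :: "real \<Rightarrow> real"
  assumes pos: "\<mu> > 0" "a\<^sub>1 > 0" "a\<^sub>2 > 0" "p\<^sub>1 > 0" "p\<^sub>2 > 0"
    and T: "T = p\<^sub>1 + p\<^sub>2"
    and a_periodic: "\<And>t. a (t + T) = a t"
    and a_first: "\<And>t. 0 \<le> t \<Longrightarrow> t < p\<^sub>1 \<Longrightarrow> a t = a\<^sub>1"
    and a_second: "\<And>t. p\<^sub>1 \<le> t \<Longrightarrow> t < T \<Longrightarrow> a t = a\<^sub>2"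
    and m: "m = (2 * (a\<^sub>2 / a\<^sub>1) - exp (- \<mu>)) * (2 - exp (- \<mu>)) * exp (- \<mu> * (T - 2))"
    and b: "b = (2 * a\<^sub>2 - a\<^sub>1 * exp (- \<mu>)) / \<mu> * (2 - exp (- \<mu>)) * exp (- \<mu> * (T - 2))
                + (a\<^sub>1 - a\<^sub>2) / \<mu> * exp (- \<mu> * p\<^sub>2) - a\<^sub>2 / \<mu>"
    and m_less: "\<bar>m\<bar> < 1"
    and b_pos: "b > 0"
    and h: "h = b / (1 - m)"
    and t1: "t\<^sub>1 = 1 / \<mu> * ln ((\<mu> * h + a\<^sub>1) / a\<^sub>1)"
    and t2: "t\<^sub>2 = t\<^sub>1 + 1 + 1 / \<mu> * ln (2 - exp (- \<mu>))"
    and order: "0 < t\<^sub>1" "t\<^sub>1 < t\<^sub>1 + 1" "t\<^sub>1 + 1 < t\<^sub>2" "t\<^sub>2 < p\<^sub>1" "p\<^sub>1 < t\<^sub>2 + 1" "t\<^sub>2 + 1 < T"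
  shows "h > 0 \<and>
    (\<exists>y. dde_forward_solution \<mu> a (\<lambda>_. h) y \<and>
         (\<forall>y'. dde_forward_solution \<mu> a (\<lambda>_. h) y' \<longrightarrow> (\<forall>t\<ge>-1. y' t = y t)) \<and>
         (\<exists>x. dde_solution \<mu> a x \<and>
              (\<forall>t. x (t + T) = x t) \<and>
              slowly_oscillating x \<and>
              lyapunov_stable \<mu> a x \<and>
              (\<forall>s\<in>{-1..0}. state x 0 s = y (T + s)) \<and>
              dde_solution \<mu> a (\<lambda>t. - x t) \<and>
              (\<forall>t. - x (t + T) = - x t)))"
proof -
  note ordering = order
  interpret periodic_negative_feedback \<mu> a\<^sub>1 a\<^sub>2 p\<^sub>1 T a
    using pos T a_periodic a_first a_second by unfold_locales auto
  have return: "return u = m * u + b" for u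
  proof -
    have "p\<^sub>2 = T - p\<^sub>1"
      using T by simp
    then show ?thesis
      by (simp add: return_def m b)
  qed
  have "m < 1"
    using m_less by simp
  then have "h > 0"
    using b_pos by (simp add: h)
  \<comment> \<open>The value \<open>b / (1 - m)\<close> is the fixed point of
    \<open>m * u + b\<close>.\<close>
  have fixed: "return h = h"
    using \<open>m < 1\<close> by (simp add: return h field_simps)
  have "t\<^sub>1 = zero1 h" "t\<^sub>2 = zero2 h"
    by (simp_all add: t1 t2 zero1_def zero2_def)
  then have adm: "admissible h"
    using \<open>h > 0\<close> ordering fixed by (simp add: admissible_def)
  have "\<bar>slope\<bar> < 1"
    using m_less by (simp add: slope_def m)
  then have stable: "lyapunov_stable \<mu> a (extension h)"
    by (rule extension_stable[OF adm fixed])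
  note solution = extension_solution[OF adm fixed]
  show ?thesis
    by (rule conjI[OF \<open>h > 0\<close> exI[of _ "glue (\<lambda>_. h) (\<lambda>_. h)"]])
      (intro conjI allI impI ballI exI[of _ "extension h"] solution dde_solution_uminus[OF solution]
        stable forward_solution[OF adm fixed] forward_unique[OF adm fixed]
        extension_slowly_oscillating[OF adm fixed] state_extension[OF adm fixed];
        simp add: extension_periodic)
qed

end
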